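(* Let $\mathcal{H}$ be a complex Hilbert space and let $B,C\in\mathcal{B}(\mathcal{H})$ be self-adjoint. Then $$\max\left\{\|B+C\|^2,\|B-C\|^2\right\}\le\|B^2+C^2\|+2\,w(|B||C|).$$
   Context: $\mathcal{B}(\mathcal{H})$ is the algebra of bounded linear operators on $\mathcal{H}$ with operator norm $\|\cdot\|$. For $A\in\mathcal{B}(\mathcal{H})$, $|A|=(A^*A)^{1/2}$ and $w(A)=\sup_{\|x\|=1}|\langle Ax,x\rangle|$ is the numerical radius. *)

theory Defs
  imports "HOL-Analysis.Analysis"
begin

class chilbert = real_normed_vector + complete_space +
  fixes scaleC :: "complex \<Rightarrow> 'a \<Rightarrow> 'a" (infixr \<open>*\<^sub>C\<close> 75)
    and cinner :: "'a \<Rightarrow> 'a \<Rightarrow> complex"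
  assumes scaleC_of_real: "scaleC (of_real r) x = scaleR r x"
    and scaleC_add_right: "scaleC a (x + y) = scaleC a x + scaleC a y"
    and scaleC_add_left: "scaleC (a + b) x = scaleC a x + scaleC b x"
    and scaleC_scaleC: "scaleC a (scaleC b x) = scaleC (a * b) x"
    and cinner_commute: "cinner x y = cnj (cinner y x)"
    and cinner_add_left: "cinner (x + y) z = cinner x z + cinner y z"
    and cinner_scaleC_left: "cinner (scaleC c x) y = c * cinner x y"
    and cinner_ge_zero: "0 \<le> Re (cinner x x)"
    and norm_cinner: "norm x = sqrt (Re (cinner x x))"

definition bounded_op :: "('a::chilbert \<Rightarrow> 'a) \<Rightarrow> bool" where
  "bounded_op A \<longleftrightarrow> bounded_linear A \<and> (\<forall>c x. A (c *\<^sub>C x) = c *\<^sub>C A x)"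

definition self_adjoint :: "('a::chilbert \<Rightarrow> 'a) \<Rightarrow> bool" where
  "self_adjoint A \<longleftrightarrow> (\<forall>x y. cinner (A x) y = cinner x (A y))"

definition adjoint_op :: "('a::chilbert \<Rightarrow> 'a) \<Rightarrow> ('a \<Rightarrow> 'a)" where
  "adjoint_op A = (THE A'. \<forall>x y. cinner (A x) y = cinner x (A' y))"

definition positive_op :: "('a::chilbert \<Rightarrow> 'a) \<Rightarrow> bool" where
  "positive_op P \<longleftrightarrow> (\<forall>x. Im (cinner (P x) x) = 0 \<and> 0 \<le> Re (cinner (P x) x))"

definition op_abs :: "('a::chilbert \<Rightarrow> 'a) \<Rightarrow> ('a \<Rightarrow> 'a)" where
  "op_abs A = (THE P. bounded_op P \<and> positive_op P \<and> P \<circ> P = adjoint_op A \<circ> A)"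

definition numrad :: "('a::chilbert \<Rightarrow> 'a) \<Rightarrow> real" where
  "numrad A = (if {x::'a. norm x = 1} = {} then 0
               else (SUP x\<in>{x. norm x = 1}. cmod (cinner (A x) x)))"

end

theory Submission
  imports Defs
begin

text \<open>Since \<open>\<plusminus>B \<le> |B|\<close> and \<open>\<plusminus>C \<le> |C|\<close>, the numerical range of \<open>B \<plusminus> C\<close> is dominated by that of
  \<open>|B| + |C|\<close>, hence \<open>\<parallel>B \<plusminus> C\<parallel> \<le> \<parallel>|B| + |C|\<parallel>\<close>; now expand
  \<open>\<parallel>(|B| + |C|) x\<parallel>\<^sup>2 = \<langle>(B\<^sup>2 + C\<^sup>2) x, x\<rangle> + 2 Re \<langle>|B| |C| x, x\<rangle>\<close>.
  The absolute value exists by the binomial series of \<open>sqrt (1 - t)\<close>, whose coefficients are absolutely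
  summable, so that it converges for every contraction. Both \<open>\<plusminus>B \<le> |B|\<close> and the uniqueness of the
  positive square root follow from one statement: if \<open>P \<ge> 0\<close> and \<open>P\<^sup>2 = B\<^sup>2\<close> then \<open>B \<le> P\<close>.
  Only the real part of the inner product matters for these arguments.\<close>

section \<open>The real inner product and the Cauchy-Schwarz inequality\<close>

instance chilbert \<subseteq> banach ..

definition rinner :: "'a::chilbert \<Rightarrow> 'a \<Rightarrow> real" where
  "rinner x y = Re (cinner x y)"

lemma rinner_commute: "rinner x y = rinner y x"
  unfolding rinner_def by (subst cinner_commute) simp

lemma rinner_add_left: "rinner (x + y) z = rinner x z + rinner y z"
  by (simp add: rinner_def cinner_add_left)

lemma rinner_scaleR_left: "rinner (r *\<^sub>R x) y = r * rinner x y"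
  by (simp add: rinner_def scaleC_of_real[symmetric] cinner_scaleC_left)

lemma rinner_self: "rinner x x = (norm x)\<^sup>2"
  by (simp add: rinner_def norm_cinner cinner_ge_zero)

lemma rinner_add_right: "rinner z (x + y) = rinner z x + rinner z y"
  by (metis rinner_add_left rinner_commute)

lemma rinner_scaleR_right: "rinner x (r *\<^sub>R y) = r * rinner x y"
  by (metis rinner_scaleR_left rinner_commute)

lemma rinner_diff_left: "rinner (x - y) z = rinner x z - rinner y z"
  using rinner_add_left[of x "(-1) *\<^sub>R y" z] by (simp only: rinner_scaleR_left) simp

lemma rinner_diff_right: "rinner z (x - y) = rinner z x - rinner z y"
  by (metis rinner_diff_left rinner_commute)

lemma norm_add_sq: "(norm (x + y))\<^sup>2 = (norm x)\<^sup>2 + 2 * rinner x y + (norm y)\<^sup>2"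
  for x y :: "'a::chilbert"
  unfolding rinner_self[symmetric]
  by (simp add: rinner_add_left rinner_add_right rinner_commute[of y x])

lemma norm_diff_sq: "(norm (x - y))\<^sup>2 = (norm x)\<^sup>2 - 2 * rinner x y + (norm y)\<^sup>2"
  for x y :: "'a::chilbert"
  unfolding rinner_self[symmetric]
  by (simp add: rinner_diff_left rinner_diff_right rinner_commute[of y x])

lemma rinner_zero_left [simp]: "rinner 0 x = 0"
  using rinner_scaleR_left[of 0 0 x] by simp

lemma rinner_zero_right [simp]: "rinner x 0 = 0"
  using rinner_scaleR_right[of x 0 0] by simp

lemma rinner_le_norm: "rinner x y \<le> norm x * norm y"
proof (cases "x = 0 \<or> y = 0")
  case False
  \<comment> \<open>The weights give both vectors equal length, so that the square factors through
    \<open>norm x * norm y - rinner x y\<close>.\<close>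
  have "0 \<le> (norm (norm y *\<^sub>R x - norm x *\<^sub>R y))\<^sup>2" by simp
  also have "\<dots> = 2 * (norm x * norm y) * (norm x * norm y - rinner x y)"
    unfolding norm_diff_sq
    by (simp add: rinner_scaleR_left rinner_scaleR_right power2_eq_square algebra_simps)
  finally show ?thesis using False by (simp add: zero_le_mult_iff mult_le_0_iff)
qed auto

lemma abs_rinner_le_norm: "\<bar>rinner x y\<bar> \<le> norm x * norm y"
  using rinner_le_norm[of x y] rinner_le_norm[of "(-1) *\<^sub>R x" y]
  by (simp only: rinner_scaleR_left) (simp add: abs_le_iff)

text \<open>Makes continuity of the form available, so that series pass through it termwise.\<close>

interpretation rinner: bounded_bilinear rinner
  by (rule bounded_bilinear.intro)
    (auto simp: rinner_add_left rinner_add_right rinner_scaleR_left rinner_scaleR_right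
      intro!: exI[of _ 1] abs_rinner_le_norm)

lemma norm_scaleC: "norm (c *\<^sub>C x) = cmod c * norm x" for x :: "'a::chilbert"
proof -
  have "cinner (c *\<^sub>C x) (c *\<^sub>C x) = c * cnj c * cinner x x"
    using cinner_commute[of x "c *\<^sub>C x"] cinner_commute[of x x]
    by (simp add: cinner_scaleC_left)
  also have "c * cnj c = of_real ((cmod c)\<^sup>2)" using complex_norm_square[of c] by simp
  finally have "(norm (c *\<^sub>C x))\<^sup>2 = (cmod c * norm x)\<^sup>2"
    by (simp add: rinner_self[symmetric] rinner_def power_mult_distrib)
  then show ?thesis by simp
qed

text \<open>Multiplying \<open>x\<close> by a phase makes the inner product real and nonnegative,
  which reduces the claim to the real inequality.\<close>

lemma cmod_cinner_le_norm: "cmod (cinner x y) \<le> norm x * norm y"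
proof -
  define u where "u = cnj (sgn (cinner x y))"
  have "cnj (sgn z) * z = of_real (cmod z)" for z
    by (cases "z = 0") (auto simp: sgn_eq complex_norm_square[symmetric] field_simps power2_eq_square)
  then have "cmod (cinner x y) = rinner (u *\<^sub>C x) y"
    by (simp add: rinner_def cinner_scaleC_left u_def)
  also have "\<dots> \<le> cmod u * norm x * norm y"
    using rinner_le_norm[of "u *\<^sub>C x" y] by (simp add: norm_scaleC)
  also have "\<dots> \<le> 1 * norm x * norm y"
    by (intro mult_right_mono) (auto simp: u_def norm_sgn)
  finally show ?thesis by simp
qed

lemma Im_cinner: "Im (cinner x y) = - rinner (\<i> *\<^sub>C x) y"
  by (simp add: rinner_def cinner_scaleC_left)

lemma rinner_scaleC_ii: "rinner (\<i> *\<^sub>C x) (\<i> *\<^sub>C y) = rinner x y"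
  using cinner_commute[of x "\<i> *\<^sub>C y"] cinner_commute[of x y]
  by (simp add: rinner_def cinner_scaleC_left)

section \<open>Symmetric operators and their quadratic forms\<close>

text \<open>Symmetry for the real form passes to sums and real multiples by bilinearity; for
  complex-linear operators it is equivalent to \<open>self_adjoint\<close>.\<close>

definition rsymmetric :: "('a::chilbert \<Rightarrow> 'a) \<Rightarrow> bool" where
  "rsymmetric A \<longleftrightarrow> (\<forall>x y. rinner (A x) y = rinner x (A y))"

lemma rsymmetricD: "rsymmetric A \<Longrightarrow> rinner (A x) y = rinner x (A y)"
  by (simp add: rsymmetric_def)

lemma self_adjoint_rsymmetric: "self_adjoint A \<Longrightarrow> rsymmetric A"
  by (simp add: self_adjoint_def rsymmetric_def rinner_def)

text \<open>Complex linearity and symmetry move \<open>\<i>\<close> across the inner product, so the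
  imaginary part equals its own negative.\<close>

lemma rsymmetric_Im_zero:
  assumes "bounded_op A" "rsymmetric A"
  shows "Im (cinner (A x) x) = 0"
proof -
  have "Im (cinner (A x) x) = - rinner (A (\<i> *\<^sub>C x)) x"
    using assms by (simp add: Im_cinner bounded_op_def)
  also have "\<dots> = Im (cinner x (A x))"
    using assms by (simp add: Im_cinner rsymmetricD)
  also have "\<dots> = - Im (cinner (A x) x)" by (subst cinner_commute) simp
  finally show ?thesis by simp
qed

text \<open>Since \<open>rinner (\<i> *\<^sub>C P x) x\<close> vanishes, polarization makes this
  form skew; substituting \<open>\<i> *\<^sub>C y\<close> for \<open>y\<close> turns skewness into
  symmetry of \<open>P\<close>.\<close>

lemma positive_op_rsymmetric:
  assumes "bounded_op P" "positive_op P"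
  shows "rsymmetric P"
  unfolding rsymmetric_def
proof (intro allI)
  fix x y
  interpret P: bounded_linear P using assms by (simp add: bounded_op_def)
  have comm: "P (\<i> *\<^sub>C x) = \<i> *\<^sub>C P x" for x using assms by (simp add: bounded_op_def)
  have z: "rinner (\<i> *\<^sub>C P x) x = 0" for x
    using assms Im_cinner[of "P x" x] by (simp add: positive_op_def)
  have anti: "rinner (\<i> *\<^sub>C P x) y = - rinner (\<i> *\<^sub>C P y) x" for x y
    using z[of "x + y"] z[of x] z[of y]
    by (simp add: P.add scaleC_add_right rinner.add_left rinner.add_right)
  have "rinner (P x) y = rinner (\<i> *\<^sub>C P x) (\<i> *\<^sub>C y)" by (simp add: rinner_scaleC_ii)
  also have "\<dots> = - rinner (\<i> *\<^sub>C \<i> *\<^sub>C P y) x" using anti by (simp add: comm)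
  also have "\<i> *\<^sub>C \<i> *\<^sub>C P y = - P y"
    using scaleC_of_real[of "-1" "P y"] by (simp add: scaleC_scaleC)
  finally show "rinner (P x) y = rinner x (P y)"
    by (simp add: rinner.minus_left rinner_commute[of "P y"])
qed

text \<open>Polarization expresses \<open>rinner (A x) y\<close> by the quadratic form at
  \<open>x + y\<close> and \<open>x - y\<close>, and the parallelogram law adds up the two
  bounds.\<close>

lemma norm_le_of_rinner_bound:
  assumes A: "linear A" "rsymmetric A"
    and bd: "\<And>x. \<bar>rinner (A x) x\<bar> \<le> k * (norm x)\<^sup>2"
  shows "norm (A x) \<le> k * norm x"
proof (cases "A x = 0 \<or> x = 0")
  case True
  \<comment> \<open>The sign of \<open>k\<close> comes from \<open>bd\<close>: a nonzero
    \<open>x\<close> forces \<open>k\<close> to be nonnegative.\<close>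
  have "0 \<le> k * (norm x)\<^sup>2" using bd[of x] by linarith
  then have "0 \<le> k * norm x" by (cases "x = 0") (auto simp: zero_le_mult_iff)
  with True show ?thesis using linear_0[OF A(1)] by auto
next
  case False
  \<comment> \<open>Direction \<open>A x\<close> gives equality in Cauchy-Schwarz; length
    \<open>norm x\<close> makes the parallelogram sum \<open>4 * (norm x)\<^sup>2\<close>.\<close>
  define y where "y = (norm x / norm (A x)) *\<^sub>R A x"
  have ny: "norm y = norm x" using False by (simp add: y_def)
  have "4 * rinner (A x) y = rinner (A (x + y)) (x + y) - rinner (A (x - y)) (x - y)"
    using rsymmetricD[OF A(2), of y x]
    by (simp add: linear_add[OF A(1)] linear_diff[OF A(1)] rinner.add_left rinner.add_right
        rinner.diff_left rinner.diff_right rinner_commute[of y "A x"])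
  also have "\<dots> \<le> k * (norm (x + y))\<^sup>2 + k * (norm (x - y))\<^sup>2"
    using bd[of "x + y"] bd[of "x - y"] by linarith
  also have "\<dots> = 4 * k * (norm x)\<^sup>2"
    by (simp add: norm_add_sq norm_diff_sq ny algebra_simps)
  also have "rinner (A x) y = norm x * norm (A x)"
    using False by (simp add: y_def rinner.scaleR_right rinner_self power2_eq_square)
  finally show ?thesis using False by (simp add: power2_eq_square)
qed

section \<open>Comparison of quadratic forms and uniqueness of positive square roots\<close>

text \<open>Positivity at \<open>x - t *\<^sub>R A x\<close> shows that a small value of the form
  forces a small image; this turns near-minimizers into approximate eigenvectors.\<close>

lemma rsymmetric_positive_norm_sq_le:
  assumes A: "linear A" "rsymmetric A" and pos: "\<And>x. 0 \<le> rinner (A x) x"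
    and bd: "\<And>x. norm (A x) \<le> K * norm x" and K: "K > 0"
  shows "(norm (A x))\<^sup>2 \<le> K * rinner (A x) x"
proof -
  \<comment> \<open>This \<open>t\<close> minimizes \<open>-2 * t + K * t\<^sup>2\<close>, the
    coefficient of the squared norm of \<open>A x\<close>.\<close>
  define t where "t = 1 / K"
  let ?y = "A x"
  have "0 \<le> rinner (A (x - t *\<^sub>R ?y)) (x - t *\<^sub>R ?y)" by (rule pos)
  also have "\<dots> = rinner (A x) x - 2 * t * (norm ?y)\<^sup>2 + t\<^sup>2 * rinner (A ?y) ?y"
    using rsymmetricD[OF A(2), of ?y x]
    by (simp add: linear_diff[OF A(1)] linear_scale[OF A(1)] rinner.diff_left rinner.diff_right
        rinner.scaleR_left rinner.scaleR_right rinner_self power2_eq_square algebra_simps)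
  also have "\<dots> \<le> rinner (A x) x - 2 * t * (norm ?y)\<^sup>2 + t\<^sup>2 * (K * (norm ?y)\<^sup>2)"
  proof -
    have "rinner (A ?y) ?y \<le> norm (A ?y) * norm ?y" by (rule rinner_le_norm)
    also have "\<dots> \<le> K * norm ?y * norm ?y" by (intro mult_right_mono bd) auto
    finally show ?thesis by (simp add: mult_left_mono power2_eq_square)
  qed
  also have "\<dots> = rinner (A x) x - (norm ?y)\<^sup>2 / K"
    using K by (simp add: t_def power2_eq_square field_simps)
  finally show ?thesis using K by (simp add: field_simps)
qed

text \<open>With \<open>M = P - B\<close> the hypothesis gives \<open>\<parallel>M x\<parallel>\<^sup>2 = 2 \<langle>P x, M x\<rangle>\<close>. If the infimum \<open>-m\<close> of the
  numerical range of \<open>M\<close> were negative, an approximate eigenvector for \<open>-m\<close> would make the left side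
  close to \<open>m\<^sup>2\<close> and the right side close to \<open>-2 m \<langle>P x, x\<rangle> \<le> 0\<close>.\<close>

lemma rinner_le_of_norm_eq:
  assumes P: "bounded_linear P" "rsymmetric P" and B: "bounded_linear B" "rsymmetric B"
    and pos: "\<And>x. 0 \<le> rinner (P x) x" and eq: "\<And>x. norm (P x) = norm (B x)"
  shows "rinner (B x) x \<le> rinner (P x) x"
proof (rule ccontr)
  assume neg: "\<not> rinner (B x) x \<le> rinner (P x) x"
  define M where "M x = P x - B x" for x
  have M: "bounded_linear M" unfolding M_def by (intro bounded_linear_sub P B)
  interpret M: bounded_linear M by (rule M)
  have Mneg: "rinner (M x) x < 0"
    using neg by (simp add: M_def rinner.diff_left)
  have Msym: "rsymmetric M"
    using P B by (simp add: rsymmetric_def M_def rinner.diff_left rinner.diff_right)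
  have Msq: "(norm (M x))\<^sup>2 = 2 * rinner (P x) (M x)" for x
    by (simp add: M_def norm_diff_sq rinner.diff_right rinner_self eq)
  obtain p where p: "p > 0" "\<And>x. norm (P x) \<le> norm x * p"
    using bounded_linear.pos_bounded[OF P(1)] by blast
  obtain k where k: "k > 0" "\<And>x. norm (M x) \<le> norm x * k"
    using M.pos_bounded by blast
  define W where "W = (\<lambda>x. rinner (M x) x) ` {x. norm x = 1}"
  have bdd: "bdd_below W"
  proof (rule bdd_belowI)
    fix w assume "w \<in> W"
    then obtain x where x: "norm x = 1" "w = rinner (M x) x" by (auto simp: W_def)
    show "- k \<le> w" using abs_rinner_le_norm[of "M x" x] k(2)[of x] x by simp
  qed
  have mem: "rinner (M x) x / (norm x)\<^sup>2 \<in> W" if "x \<noteq> 0" for x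
    unfolding W_def using that
    by (intro image_eqI[of _ _ "(1 / norm x) *\<^sub>R x"])
      (auto simp: M.scaleR rinner.scaleR_left rinner.scaleR_right power2_eq_square)
  have "x \<noteq> 0" using Mneg by auto
  define m where "m = - Inf W"
  have low: "rinner (M x) x \<ge> - m * (norm x)\<^sup>2" for x
    using cInf_lower[OF mem bdd, of x] by (cases "x = 0") (auto simp: m_def field_simps)
  have "W \<noteq> {}" using mem[OF \<open>x \<noteq> 0\<close>] by blast
  have "m > 0"
    using cInf_lower[OF mem[OF \<open>x \<noteq> 0\<close>] bdd] Mneg \<open>x \<noteq> 0\<close>
    by (smt (verit) m_def divide_neg_pos zero_less_norm_iff zero_less_power)
  \<comment> \<open>Adding \<open>m\<close> shifts the infimum of the form to zero, so
    \<open>S\<close> is positive and \<open>norm (S y)\<close> measures how far \<open>y\<close> is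
    from an eigenvector for \<open>-m\<close>.\<close>
  define S where "S x = M x + m *\<^sub>R x" for x
  have Slin: "linear S"
    unfolding S_def by (intro linear_compose_add bounded_linear.linear[OF M] linear_scaleR)
  have Ssym: "rsymmetric S"
    using Msym by (simp add: rsymmetric_def S_def rinner.add_left rinner.add_right
        rinner.scaleR_left rinner.scaleR_right)
  have Spos: "0 \<le> rinner (S x) x" for x
    using low[of x] by (simp add: S_def rinner.add_left rinner.scaleR_left rinner_self)
  have Sbd: "norm (S x) \<le> (k + m) * norm x" for x
    using norm_triangle_ineq[of "M x" "m *\<^sub>R x"] k(2)[of x] \<open>m > 0\<close>
    by (simp add: S_def algebra_simps)
  \<comment> \<open>Putting \<open>M y = S y - m *\<^sub>R y\<close> into \<open>Msq\<close> leaves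
    the nonpositive term \<open>- 2 * m * rinner (P y) y\<close>; dropping it bounds
    \<open>M y\<close> by \<open>S y\<close>, and \<open>m\<close> is at most the sum of both
    norms.\<close>
  have key: "m\<^sup>2 \<le> 4 * p * norm (S y) + 2 * (norm (S y))\<^sup>2" if y: "norm y = 1" for y
  proof -
    have "(norm (M y))\<^sup>2 = 2 * rinner (P y) (S y) - 2 * m * rinner (P y) y"
      by (simp add: Msq S_def rinner.add_right rinner.scaleR_right)
    also have "\<dots> \<le> 2 * rinner (P y) (S y)" using pos[of y] \<open>m > 0\<close> by simp
    also have "rinner (P y) (S y) \<le> p * norm (S y)"
      using rinner_le_norm[of "P y" "S y"] mult_right_mono[OF p(2)[of y], of "norm (S y)"] y
      by simp
    finally have 1: "(norm (M y))\<^sup>2 \<le> 2 * p * norm (S y)" by simp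
    have "m = norm (S y - M y)" using y \<open>m > 0\<close> by (simp add: S_def)
    also have "\<dots> \<le> norm (S y) + norm (M y)" by (rule norm_triangle_ineq4)
    finally have "m\<^sup>2 \<le> (norm (S y) + norm (M y))\<^sup>2" using \<open>m > 0\<close> by (simp add: power_mono)
    also have "\<dots> \<le> 2 * (norm (S y))\<^sup>2 + 2 * (norm (M y))\<^sup>2"
      using sum_squares_bound[of "norm (S y)" "norm (M y)"] by (simp add: power2_sum)
    finally show ?thesis using 1 by linarith
  qed
  \<comment> \<open>A threshold contradicting \<open>key\<close>: as
    \<open>q\<^sup>2 \<le> q\<close>, a vector with \<open>norm (S y) < q\<close> makes the right
    side at most \<open>(4 * p + 2) * q\<close>, and the \<open>3\<close> leaves strict room below
    \<open>m\<^sup>2\<close>.\<close>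
  define q where "q = min 1 (m\<^sup>2 / (4 * p + 3))"
  have q: "0 < q" "q \<le> 1" "(4 * p + 3) * q \<le> m\<^sup>2"
  proof -
    have "q \<le> m\<^sup>2 / (4 * p + 3)" by (simp add: q_def)
    then show "(4 * p + 3) * q \<le> m\<^sup>2" using p by (simp add: pos_le_divide_eq mult.commute)
  qed (use p \<open>m > 0\<close> in \<open>auto simp: q_def\<close>)
  \<comment> \<open>The slack \<open>q\<^sup>2 / (k + m)\<close> cancels the factor
    \<open>k + m\<close> incurred in passing from the form of \<open>S\<close> to its norm.\<close>
  have "Inf W < Inf W + q\<^sup>2 / (k + m)" using q k \<open>m > 0\<close> by simp
  then obtain w where "w \<in> W" "w < Inf W + q\<^sup>2 / (k + m)"
    using cInf_lessD[OF \<open>W \<noteq> {}\<close>] by blast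
  then obtain y where y: "norm y = 1" "rinner (M y) y < Inf W + q\<^sup>2 / (k + m)"
    by (auto simp: W_def)
  have "rinner (S y) y < q\<^sup>2 / (k + m)"
    using y unfolding S_def rinner.add_left rinner.scaleR_left rinner_self by (simp add: m_def)
  then have "(k + m) * rinner (S y) y < q\<^sup>2" using k \<open>m > 0\<close> by (simp add: field_simps)
  with rsymmetric_positive_norm_sq_le[OF Slin Ssym Spos Sbd, of y] k \<open>m > 0\<close>
  have "(norm (S y))\<^sup>2 < q\<^sup>2" by simp
  then have Sq: "norm (S y) < q" using q by (simp add: power2_less_imp_less)
  have "m\<^sup>2 \<le> 4 * p * norm (S y) + 2 * (norm (S y))\<^sup>2" by (rule key[OF y(1)])
  also have "\<dots> \<le> 4 * p * q + 2 * q"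
  proof -
    have "(norm (S y))\<^sup>2 \<le> q * 1"
      unfolding power2_eq_square using Sq q by (intro mult_mono) auto
    moreover have "p * norm (S y) \<le> p * q" using Sq p by simp
    ultimately show ?thesis by simp
  qed
  also have "\<dots> < (4 * p + 3) * q" using q by (simp add: algebra_simps)
  finally show False using q by simp
qed

text \<open>\<open>- B\<close> has the same norms as \<open>B\<close>, so the one-sided comparison
  applies to both signs.\<close>

lemma abs_rinner_le_of_norm_eq:
  assumes P: "bounded_linear P" "rsymmetric P" and B: "bounded_linear B" "rsymmetric B"
    and pos: "\<And>x. 0 \<le> rinner (P x) x" and eq: "\<And>x. norm (P x) = norm (B x)"
  shows "\<bar>rinner (B x) x\<bar> \<le> rinner (P x) x"
proof -
  have "rsymmetric (\<lambda>x. - B x)"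
    using B by (simp add: rsymmetric_def rinner.minus_left rinner.minus_right)
  then show ?thesis
    using rinner_le_of_norm_eq[OF P B pos eq, of x]
      rinner_le_of_norm_eq[OF P bounded_linear_minus[OF B(1)], of x] pos eq
    by (simp add: rinner.minus_left)
qed

lemma rsymmetric_norm_eq:
  assumes "rsymmetric P" "rsymmetric B" "P \<circ> P = B \<circ> B"
  shows "norm (P x) = norm (B x)"
proof -
  have "(norm (P x))\<^sup>2 = rinner x (P (P x))"
    using assms(1) by (simp add: rinner_self[symmetric] rsymmetricD)
  also have "\<dots> = rinner x (B (B x))" using assms(3) by (metis comp_apply)
  also have "\<dots> = (norm (B x))\<^sup>2"
    using assms(2) by (simp add: rinner_self[symmetric] rsymmetricD)
  finally show ?thesis by simp
qed

lemma positive_op_rinner: "positive_op P \<Longrightarrow> 0 \<le> rinner (P x) x"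
  by (simp add: positive_op_def rinner_def)

text \<open>Comparison in both directions gives equal quadratic forms; the difference is symmetric
  with zero form, hence zero.\<close>

lemma positive_sqrt_unique:
  assumes P: "bounded_op P" "positive_op P" and Q: "bounded_op Q" "positive_op Q"
    and eq: "P \<circ> P = Q \<circ> Q"
  shows "P = Q"
proof
  fix x
  note sym = positive_op_rsymmetric[OF P] positive_op_rsymmetric[OF Q]
  have bl: "bounded_linear P" "bounded_linear Q" using P Q by (auto simp: bounded_op_def)
  have "rinner (P x) x = rinner (Q x) x" for x
    using rinner_le_of_norm_eq[OF bl(1) sym(1) bl(2) sym(2), of x]
      rinner_le_of_norm_eq[OF bl(2) sym(2) bl(1) sym(1), of x]
      rsymmetric_norm_eq[OF sym eq] P(2) Q(2) by (force simp: positive_op_rinner)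
  moreover have "linear (\<lambda>x. P x - Q x)"
    using bl by (intro linear_compose_sub bounded_linear.linear)
  moreover have "rsymmetric (\<lambda>x. P x - Q x)"
    using sym by (simp add: rsymmetric_def rinner.diff_left rinner.diff_right)
  ultimately have "norm (P x - Q x) \<le> 0 * norm x"
    by (intro norm_le_of_rinner_bound) (auto simp: rinner.diff_left)
  then show "P x = Q x" by simp
qed

section \<open>Coefficients of the binomial series of \<open>sqrt (1 - t)\<close>\<close>

definition sqrt_coeff :: "nat \<Rightarrow> real" where
  "sqrt_coeff k = (1/2 gchoose k) * (-1) ^ k"

lemma sqrt_coeff_0 [simp]: "sqrt_coeff 0 = 1"
  by (simp add: sqrt_coeff_def)

text \<open>Of the factors of the Pochhammer symbol only the first, \<open>-1/2\<close>, is
  negative.\<close>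

lemma sqrt_coeff_nonpos: "sqrt_coeff (Suc k) \<le> 0"
proof -
  have "sqrt_coeff (Suc k) = pochhammer (-1/2) (Suc k) / fact (Suc k)"
    unfolding sqrt_coeff_def gbinomial_pochhammer
    by (simp add: power_mult_distrib[symmetric])
  also have "pochhammer (-1/2::real) (Suc k) = -1/2 * pochhammer (1/2) k"
    by (simp add: pochhammer_rec)
  finally show ?thesis
    using pochhammer_nonneg[of "1/2::real" k] by (simp add: divide_nonpos_pos)
qed

text \<open>Dividing \<open>sqrt (1 - t)\<close> by \<open>1 - t\<close> gives
  \<open>1 / sqrt (1 - t)\<close>, so these partial sums are the coefficients of the latter, which
  are positive.\<close>

lemma sum_sqrt_coeff_nonneg: "0 \<le> (\<Sum>k\<le>n. sqrt_coeff k)"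
proof -
  have "(\<Sum>k\<le>n. sqrt_coeff k) = (-1) ^ n * (-1/2 gchoose n)"
    unfolding sqrt_coeff_def by (subst gbinomial_sum_lower_neg) simp
  also have "\<dots> = pochhammer (1/2) n / fact n"
    unfolding gbinomial_pochhammer by (simp add: power_mult_distrib[symmetric])
  finally show ?thesis by (simp add: pochhammer_nonneg)
qed

text \<open>Only the constant coefficient is positive, so the absolute partial sums are
  \<open>2\<close> minus the nonnegative signed ones.\<close>

lemma summable_abs_sqrt_coeff: "summable (\<lambda>k. \<bar>sqrt_coeff k\<bar>)"
proof (rule summableI_nonneg_bounded)
  fix n
  have eq: "(\<Sum>k\<le>n. \<bar>sqrt_coeff k\<bar>) = 2 - (\<Sum>k\<le>n. sqrt_coeff k)" for n
    by (induction n) (use sqrt_coeff_nonpos in auto)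
  have "(\<Sum>k<n. \<bar>sqrt_coeff k\<bar>) \<le> (\<Sum>k\<le>n. \<bar>sqrt_coeff k\<bar>)" by (intro sum_mono2) auto
  with eq[of n] sum_sqrt_coeff_nonneg[of n] show "(\<Sum>k<n. \<bar>sqrt_coeff k\<bar>) \<le> 2" by simp
qed simp

text \<open>Coefficient form of squaring \<open>sqrt (1 - t)\<close>, by Vandermonde with
  \<open>1/2 + 1/2 = 1\<close>.\<close>

lemma sqrt_coeff_convolution:
  "(\<Sum>i\<le>n. sqrt_coeff i * sqrt_coeff (n - i)) = (if n = 0 then 1 else if n = 1 then -1 else 0)"
proof -
  have "(\<Sum>i\<le>n. sqrt_coeff i * sqrt_coeff (n - i))
      = (\<Sum>i\<le>n. (-1) ^ n * ((1/2 gchoose i) * (1/2 gchoose (n - i))))"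
    by (intro sum.cong refl) (simp add: sqrt_coeff_def power_add[symmetric])
  also have "\<dots> = (-1) ^ n * ((1::real) gchoose n)"
    using gbinomial_Vandermonde[of "1/2::real" "1/2" n] by (simp add: sum_distrib_left[symmetric] atLeast0AtMost)
  also have "(1::real) gchoose n = of_nat (1 choose n)"
    using binomial_gbinomial[of 1 n, where 'a = real] by simp
  finally show ?thesis by (auto simp: binomial_eq_0)
qed

section \<open>Cauchy products of vector-valued series\<close>

text \<open>Bridge to unordered sums, where double series can be reindexed.\<close>

lemma suminf_eq_infsum: "g summable_on UNIV \<Longrightarrow> suminf g = infsum g UNIV"
  for g :: "nat \<Rightarrow> 'b::banach"
  by (metis has_sum_imp_sums has_sum_infsum sums_unique)

text \<open>The vector depends only on \<open>i + j\<close>, so the double series can be grouped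
  along antidiagonals. Later \<open>v n\<close> is the \<open>n\<close>-th power of an operator at a
  vector.\<close>

lemma suminf_convolution:
  fixes v :: "nat \<Rightarrow> 'b::banach" and a :: "nat \<Rightarrow> real"
  assumes a: "summable (\<lambda>k. \<bar>a k\<bar>)" and v: "\<And>n. norm (v n) \<le> D"
  shows "(\<Sum>i. a i *\<^sub>R (\<Sum>j. a j *\<^sub>R v (i + j))) = (\<Sum>n. (\<Sum>i\<le>n. a i * a (n - i)) *\<^sub>R v n)"
proof -
  define f where "f = (\<lambda>(i, j). (a i * a j) *\<^sub>R v (i + j))"
  have as: "(\<lambda>i. \<bar>a i\<bar>) summable_on UNIV"
    using a by (intro norm_summable_imp_summable_on) auto
  \<comment> \<open>Boundedness of \<open>v\<close> gives a majorant that factors into two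
    absolutely summable series.\<close>
  have "(\<lambda>z. norm ((\<lambda>(i, j). a i * a j * D) z)) summable_on (UNIV \<times> UNIV)"
    unfolding Infinite_Sum.abs_summable_on_Sigma_iff
    by (auto simp: abs_mult infsum_cmult_right' infsum_cmult_left' mult.assoc
        intro!: summable_on_cmult_right summable_on_cmult_left as)
  then have "(\<lambda>z. norm (f z)) summable_on (UNIV \<times> UNIV)"
  proof (rule Infinite_Sum.abs_summable_on_comparison_test)
    fix z :: "nat \<times> nat"
    obtain i j where z: "z = (i, j)" by force
    have "norm (v (i + j)) \<le> \<bar>D\<bar>" using v[of "i + j"] by linarith
    then show "norm (f z) \<le> norm (case z of (i, j) \<Rightarrow> a i * a j * D)"
      by (simp add: z f_def abs_mult mult_left_mono)
  qed
  then have f: "f summable_on (UNIV \<times> UNIV)" by (rule abs_summable_summable)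
  have inner: "(\<lambda>j. a j *\<^sub>R v (i + j)) summable_on UNIV" for i
  proof (rule norm_summable_imp_summable_on, rule summable_comparison_test'[where N = 0])
    show "summable (\<lambda>j. \<bar>a j\<bar> * D)" by (intro summable_mult2 a)
    show "norm (norm (a j *\<^sub>R v (i + j))) \<le> \<bar>a j\<bar> * D" for j by (simp add: v mult_left_mono)
  qed
  have row: "infsum (\<lambda>j. f (i, j)) UNIV = a i *\<^sub>R (\<Sum>j. a j *\<^sub>R v (i + j))" for i
    using infsum_scaleR_right[of "a i" "\<lambda>j. a j *\<^sub>R v (i + j)" UNIV]
    by (simp add: f_def suminf_eq_infsum[OF inner])
  \<comment> \<open>The coordinates \<open>(n, i)\<close> with \<open>n = i + j\<close> run along
    the antidiagonals.\<close>
  define g where "g = (\<lambda>(n, i). (a i * a (n - i)) *\<^sub>R v n)"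
  have bij: "bij_betw (\<lambda>(n, i). (i, n - i)) (Sigma UNIV (\<lambda>n. {..n})) (UNIV \<times> (UNIV :: nat set))"
    by (rule bij_betw_byWitness[where f' = "\<lambda>(i, j). (i + j, i)"]) auto
  have gf: "g z = f ((\<lambda>(n, i). (i, n - i)) z)" if "z \<in> Sigma UNIV (\<lambda>n. {..n})" for z
    using that by (auto simp: f_def g_def)
  have g: "g summable_on (Sigma UNIV (\<lambda>n. {..n}))"
    using f summable_on_reindex_bij_betw[OF bij, of f] by (simp add: gf cong: summable_on_cong)
  have diag: "infsum (\<lambda>i. g (n, i)) {..n} = (\<Sum>i\<le>n. a i * a (n - i)) *\<^sub>R v n" for n
    by (simp add: g_def scaleR_sum_left)
  have "(\<Sum>i. a i *\<^sub>R (\<Sum>j. a j *\<^sub>R v (i + j))) = infsum f (UNIV \<times> UNIV)"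
    using summable_on_Sigma_banach[of "\<lambda>i j. f (i, j)" UNIV "\<lambda>_. UNIV"]
      infsum_Sigma_banach[OF f] f
    by (simp add: row suminf_eq_infsum)
  also have "\<dots> = infsum g (Sigma UNIV (\<lambda>n. {..n}))"
    using infsum_reindex_bij_betw[OF bij, of f] by (simp add: gf cong: infsum_cong)
  also have "\<dots> = (\<Sum>n. (\<Sum>i\<le>n. a i * a (n - i)) *\<^sub>R v n)"
    using summable_on_Sigma_banach[of "\<lambda>n i. g (n, i)" UNIV "\<lambda>n. {..n}"]
      infsum_Sigma_banach[OF g] g
    by (simp only: diag suminf_eq_infsum) (simp add: suminf_eq_infsum)
  finally show ?thesis .
qed

section \<open>Existence of positive square roots\<close>

lemma bounded_linear_scaleC: "bounded_linear (\<lambda>x::'a::chilbert. c *\<^sub>C x)"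
proof (rule bounded_linear_intro[where K = "cmod c"])
  fix r and x :: 'a
  show "c *\<^sub>C r *\<^sub>R x = r *\<^sub>R c *\<^sub>C x"
    by (simp add: scaleC_of_real[symmetric] scaleC_scaleC mult.commute)
qed (simp_all add: scaleC_add_right norm_scaleC)

text \<open>The root is the binomial series with \<open>T\<close> in place of \<open>t\<close>;
  powers of a contraction are contractions, so summability of the coefficients suffices.\<close>

lemma contraction_sqrt_exists:
  assumes T: "bounded_op T" "rsymmetric T" and contr: "\<And>x. norm (T x) \<le> norm x"
  shows "\<exists>S. bounded_op S \<and> positive_op S \<and> (\<forall>x. S (S x) = x - T x)"
proof -
  interpret T: bounded_linear T using T by (simp add: bounded_op_def)
  define V where "V k = T ^^ k" for k
  have Vbl: "bounded_linear (V k)" for k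
  proof (induction k)
    case (Suc k)
    have "V (Suc k) = (\<lambda>x. T (V k x))" by (simp add: V_def fun_eq_iff)
    then show ?case using bounded_linear_compose[OF T.bounded_linear_axioms Suc] by simp
  qed (simp add: V_def id_def)
  have VC: "V k (c *\<^sub>C x) = c *\<^sub>C V k x" for k c x
    using T by (induction k) (auto simp: V_def bounded_op_def)
  have Vsym: "rinner (V k x) y = rinner x (V k y)" for k x y
    by (induction k arbitrary: x y)
      (simp_all add: V_def rsymmetricD[OF T(2)] funpow_swap1)
  have Vbd: "norm (V k x) \<le> norm x" for k x
    by (induction k) (auto simp: V_def intro: order.trans[OF contr])
  define S where "S x = (\<Sum>k. sqrt_coeff k *\<^sub>R V k x)" for x
  have nsum: "summable (\<lambda>k. norm (sqrt_coeff k *\<^sub>R V k x))" for x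
  proof (rule summable_comparison_test'[where N = 0])
    show "summable (\<lambda>k. \<bar>sqrt_coeff k\<bar> * norm x)"
      by (intro summable_mult2 summable_abs_sqrt_coeff)
    show "norm (norm (sqrt_coeff k *\<^sub>R V k x)) \<le> \<bar>sqrt_coeff k\<bar> * norm x" for k
      by (simp add: Vbd mult_left_mono)
  qed
  have sums: "(\<lambda>k. sqrt_coeff k *\<^sub>R V k x) sums S x" for x
    unfolding S_def by (rule summable_sums[OF summable_norm_cancel[OF nsum]])
  have Sadd: "S (x + y) = S x + S y" for x y
    using sums_unique2[OF sums[of "x + y"]] sums_add[OF sums[of x] sums[of y]]
    by (simp add: linear_add[OF bounded_linear.linear[OF Vbl]] scaleR_add_right)
  have SR: "S (r *\<^sub>R x) = r *\<^sub>R S x" for r x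
    using sums_unique2[OF sums[of "r *\<^sub>R x"]] sums_scaleR_right[OF sums[of x], of r]
    by (simp add: linear_scale[OF bounded_linear.linear[OF Vbl]] mult.commute)
  have SC: "S (c *\<^sub>C x) = c *\<^sub>C S x" for c x
    using sums_unique2[OF sums[of "c *\<^sub>C x"]]
      bounded_linear.sums[OF bounded_linear_scaleC sums[of x], of c]
    by (simp add: VC linear_scale[OF bounded_linear.linear[OF bounded_linear_scaleC]])
  have Sbd: "norm (S x) \<le> norm x * (\<Sum>k. \<bar>sqrt_coeff k\<bar>)" for x
  proof -
    have "norm (S x) \<le> (\<Sum>k. norm (sqrt_coeff k *\<^sub>R V k x))"
      unfolding S_def by (rule summable_norm[OF nsum])
    also have "\<dots> \<le> (\<Sum>k. norm x * \<bar>sqrt_coeff k\<bar>)"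
      by (intro suminf_le nsum summable_mult summable_abs_sqrt_coeff)
        (simp add: Vbd mult_left_mono mult.commute[of "norm x"])
    also have "\<dots> = norm x * (\<Sum>k. \<bar>sqrt_coeff k\<bar>)"
      by (intro suminf_mult summable_abs_sqrt_coeff)
    finally show ?thesis .
  qed
  have Sop: "bounded_op S"
    unfolding bounded_op_def using bounded_linear_intro[OF Sadd SR Sbd] SC by blast
  have Ssym: "rsymmetric S"
    unfolding rsymmetric_def
  proof (intro allI)
    fix x y
    have "(\<lambda>k. rinner (sqrt_coeff k *\<^sub>R V k x) y) sums rinner (S x) y"
      by (rule bounded_linear.sums[OF rinner.bounded_linear_left sums])
    moreover have "(\<lambda>k. rinner x (sqrt_coeff k *\<^sub>R V k y)) sums rinner x (S y)"
      by (rule bounded_linear.sums[OF rinner.bounded_linear_right sums])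
    ultimately show "rinner (S x) y = rinner x (S y)"
      by (simp add: rinner.scaleR_left rinner.scaleR_right Vsym sums_unique2)
  qed
  have Spos: "0 \<le> rinner (S x) x" for x
  proof -
    have "(\<lambda>k. rinner (sqrt_coeff k *\<^sub>R V k x) x) sums rinner (S x) x"
      by (rule bounded_linear.sums[OF rinner.bounded_linear_left sums])
    then have lim: "(\<lambda>n. \<Sum>k\<le>n. sqrt_coeff k * rinner (V k x) x) \<longlonglongrightarrow> rinner (S x) x"
      by (simp add: sums_def_le rinner.scaleR_left)
    \<comment> \<open>A nonpositive coefficient reverses the upper bound on
      \<open>rinner (V k x) x\<close>, and \<open>k = 0\<close> gives equality. Partial sums are
      thus at least a nonnegative multiple of \<open>(norm x)\<^sup>2\<close>.\<close>
    have term_le: "sqrt_coeff k * (norm x)\<^sup>2 \<le> sqrt_coeff k * rinner (V k x) x" for k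
    proof (cases k)
      case 0
      then show ?thesis by (simp add: V_def rinner_self)
    next
      case (Suc j)
      have "rinner (V k x) x \<le> norm x * norm x"
        using rinner_le_norm[of "V k x" x] mult_right_mono[OF Vbd[of k x], of "norm x"] by simp
      then show ?thesis
        using sqrt_coeff_nonpos[of j] Suc by (simp add: mult_left_mono_neg power2_eq_square)
    qed
    have "0 \<le> (\<Sum>k\<le>n. sqrt_coeff k * rinner (V k x) x)" for n
    proof -
      have "0 \<le> (\<Sum>k\<le>n. sqrt_coeff k) * (norm x)\<^sup>2" using sum_sqrt_coeff_nonneg[of n] by simp
      also have "\<dots> \<le> (\<Sum>k\<le>n. sqrt_coeff k * rinner (V k x) x)"
        unfolding sum_distrib_right by (intro sum_mono term_le)
      finally show ?thesis .
    qed
    then show ?thesis by (intro LIMSEQ_le_const[OF lim]) auto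
  qed
  have "S (S x) = x - T x" for x
  proof -
    \<comment> \<open>Continuity lets \<open>V i\<close> pass through the series of
      \<open>S x\<close>, which produces the double series in \<open>V (i + j)\<close>.\<close>
    have "V i (S x) = (\<Sum>j. sqrt_coeff j *\<^sub>R V (i + j) x)" for i
      using sums_unique[OF bounded_linear.sums[OF Vbl[of i] sums[of x]]]
      unfolding linear_scale[OF bounded_linear.linear[OF Vbl]] by (simp add: V_def funpow_add)
    then have "S (S x) = (\<Sum>i. sqrt_coeff i *\<^sub>R (\<Sum>j. sqrt_coeff j *\<^sub>R V (i + j) x))"
      by (simp add: S_def[of "S x"])
    also have "\<dots> = (\<Sum>n. (\<Sum>i\<le>n. sqrt_coeff i * sqrt_coeff (n - i)) *\<^sub>R V n x)"
      by (rule suminf_convolution[OF summable_abs_sqrt_coeff Vbd])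
    also have "\<dots> = (\<Sum>n\<in>{0, 1}. (\<Sum>i\<le>n. sqrt_coeff i * sqrt_coeff (n - i)) *\<^sub>R V n x)"
      by (rule suminf_finite) (auto simp: sqrt_coeff_convolution)
    also have "\<dots> = x - T x"
      by (simp add: sqrt_coeff_convolution V_def)
    finally show ?thesis .
  qed
  moreover have "positive_op S"
    using rsymmetric_Im_zero[OF Sop Ssym] Spos by (simp add: positive_op_def rinner_def)
  ultimately show ?thesis using Sop by blast
qed

lemma square_sqrt_exists:
  assumes B: "bounded_op B" "rsymmetric B"
  shows "\<exists>P. bounded_op P \<and> positive_op P \<and> P \<circ> P = B \<circ> B"
proof -
  interpret B: bounded_linear B using B by (simp add: bounded_op_def)
  obtain K where K: "K > 0" "\<And>x. norm (B x) \<le> norm x * K" using B.pos_bounded by blast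
  \<comment> \<open>By the choice of \<open>K\<close> the form of \<open>T\<close> lies between
    \<open>0\<close> and \<open>(norm x)\<^sup>2\<close>, so \<open>T\<close> is a contraction;
    \<open>K\<close> times a root of the identity minus \<open>T\<close> squares to
    \<open>B \<circ> B\<close>.\<close>
  define T where "T x = x - (1 / K\<^sup>2) *\<^sub>R B (B x)" for x
  have BB: "bounded_linear (\<lambda>x. (1 / K\<^sup>2) *\<^sub>R B (B x))"
    by (intro bounded_linear_const_scaleR bounded_linear_compose[OF B.bounded_linear_axioms]
        B.bounded_linear_axioms)
  have Tbl: "bounded_linear T"
    unfolding T_def by (intro bounded_linear_sub bounded_linear_ident BB)
  have Top: "bounded_op T"
    unfolding bounded_op_def
  proof (intro conjI allI Tbl)
    show "T (c *\<^sub>C x) = c *\<^sub>C T x" for c x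
      using B(1)
      by (simp add: bounded_op_def T_def linear_diff[OF bounded_linear.linear[OF bounded_linear_scaleC]]
          linear_scale[OF bounded_linear.linear[OF bounded_linear_scaleC]])
  qed
  have Tsym: "rsymmetric T"
    using B(2) by (simp add: rsymmetric_def T_def rinner.diff_left rinner.diff_right
        rinner.scaleR_left rinner.scaleR_right)
  have TB: "rinner (T x) x = (norm x)\<^sup>2 - (norm (B x))\<^sup>2 / K\<^sup>2" for x
    using B(2) by (simp add: T_def rinner.diff_left rinner.scaleR_left
        rinner_self[symmetric] rsymmetricD)
  have "\<bar>rinner (T x) x\<bar> \<le> 1 * (norm x)\<^sup>2" for x
  proof -
    have "(norm (B x))\<^sup>2 \<le> (norm x * K)\<^sup>2" using K(2)[of x] by (simp add: power_mono)
    then have "(norm (B x))\<^sup>2 / K\<^sup>2 \<le> (norm x)\<^sup>2"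
      using K(1) by (simp add: power_mult_distrib divide_le_eq)
    moreover have "0 \<le> (norm (B x))\<^sup>2 / K\<^sup>2" "0 \<le> (norm x)\<^sup>2" by simp_all
    ultimately show ?thesis unfolding TB by linarith
  qed
  from norm_le_of_rinner_bound[OF bounded_linear.linear[OF Tbl] Tsym this]
  have "norm (T x) \<le> norm x" for x by simp
  from contraction_sqrt_exists[OF Top Tsym this] obtain S where
    S: "bounded_op S" "positive_op S" "\<And>x. S (S x) = x - T x" by blast
  have Sbl: "bounded_linear S" using S(1) by (simp add: bounded_op_def)
  define P where "P x = K *\<^sub>R S x" for x
  have "bounded_op P"
    unfolding bounded_op_def
  proof (intro conjI allI)
    show "bounded_linear P" unfolding P_def by (rule bounded_linear_const_scaleR[OF Sbl])
    show "P (c *\<^sub>C x) = c *\<^sub>C P x" for c x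
      using S(1) by (simp add: bounded_op_def P_def
          linear_scale[OF bounded_linear.linear[OF bounded_linear_scaleC]])
  qed
  moreover have "positive_op P"
    using S(2) K(1)
    by (simp add: positive_op_def P_def scaleC_of_real[symmetric] cinner_scaleC_left)
  moreover have "P \<circ> P = B \<circ> B"
    using K(1) by (simp add: fun_eq_iff P_def linear_scale[OF bounded_linear.linear[OF Sbl]] S(3)
        T_def power2_eq_square)
  ultimately show ?thesis by blast
qed

section \<open>Adjoint and absolute value of a self-adjoint operator\<close>

text \<open>Any candidate differs from \<open>B\<close> by values orthogonal to every vector, which
  determines the definite description.\<close>

lemma adjoint_op_self_adjoint:
  assumes "self_adjoint B"
  shows "adjoint_op B = B"
  unfolding adjoint_op_def
proof (rule the_equality)
  show "\<forall>x y. cinner (B x) y = cinner x (B y)" using assms by (simp add: self_adjoint_def)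
next
  fix A assume A: "\<forall>x y. cinner (B x) y = cinner x (A y)"
  have "rinner x (A y - B y) = 0" for x y
    using A assms unfolding rinner.diff_right by (simp add: rinner_def self_adjoint_def)
  then have "(norm (A y - B y))\<^sup>2 = 0" for y by (metis rinner_self)
  then show "A = B" by (simp add: fun_eq_iff)
qed

text \<open>Existence and uniqueness of the positive root make the description in
  \<open>op_abs\<close> denote it.\<close>

lemma op_abs_self_adjoint:
  assumes "bounded_op B" "self_adjoint B"
  shows "bounded_op (op_abs B)" "positive_op (op_abs B)" "op_abs B \<circ> op_abs B = B \<circ> B"
proof -
  obtain P where P: "bounded_op P \<and> positive_op P \<and> P \<circ> P = B \<circ> B"
    using square_sqrt_exists[OF assms(1) self_adjoint_rsymmetric[OF assms(2)]] by blast
  have "\<exists>!P. bounded_op P \<and> positive_op P \<and> P \<circ> P = B \<circ> B"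
    using P positive_sqrt_unique by metis
  from theI'[OF this] show "bounded_op (op_abs B)" "positive_op (op_abs B)"
    "op_abs B \<circ> op_abs B = B \<circ> B"
    by (simp_all add: op_abs_def adjoint_op_self_adjoint[OF assms(2)])
qed

section \<open>Numerical radius and the norm estimate\<close>

lemma rinner_le_numrad:
  assumes "bounded_linear A"
  shows "rinner (A x) x \<le> numrad A * (norm x)\<^sup>2"
proof (cases "x = 0")
  case False
  interpret A: bounded_linear A by fact
  obtain K where K: "\<And>x. norm (A x) \<le> norm x * K" using A.bounded by blast
  define u where "u = (1 / norm x) *\<^sub>R x"
  have u: "norm u = 1" "x = norm x *\<^sub>R u" using False by (auto simp: u_def)
  \<comment> \<open>Boundedness of the family ensures that its real supremum is an upper
    bound.\<close>
  have bdd: "bdd_above ((\<lambda>x. cmod (cinner (A x) x)) ` {x. norm x = 1})"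
  proof (rule bdd_aboveI)
    fix w assume "w \<in> (\<lambda>x. cmod (cinner (A x) x)) ` {x. norm x = 1}"
    then obtain y where "norm y = 1" "w = cmod (cinner (A y) y)" by auto
    then show "w \<le> K" using cmod_cinner_le_norm[of "A y" y] K[of y] by simp
  qed
  have "rinner (A u) u \<le> cmod (cinner (A u) u)" by (simp add: rinner_def complex_Re_le_cmod)
  also have "\<dots> \<le> (SUP x\<in>{x. norm x = 1}. cmod (cinner (A x) x))"
    by (rule cSUP_upper[OF _ bdd]) (simp add: u)
  also have "\<dots> = numrad A" using u(1) by (auto simp: numrad_def)
  finally have "rinner (A u) u * (norm x)\<^sup>2 \<le> numrad A * (norm x)\<^sup>2" by (simp add: mult_right_mono)
  moreover have "rinner (A x) x = rinner (A u) u * (norm x)\<^sup>2"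
    by (subst (1 2) u(2))
      (simp add: A.scaleR rinner.scaleR_left rinner.scaleR_right power2_eq_square)
  ultimately show ?thesis by simp
qed (use assms in \<open>simp add: linear_simps\<close>)

text \<open>The form of \<open>A\<close> is at most \<open>norm (P x + Q x) * norm x\<close>, so it
  remains to expand the square of that norm.\<close>

lemma onorm_sq_le_of_abs_dominated:
  fixes A P Q :: "'a::chilbert \<Rightarrow> 'a"
  assumes A: "bounded_linear A" "rsymmetric A"
    and P: "bounded_linear P" "rsymmetric P" and Q: "bounded_linear Q" "rsymmetric Q"
    and le: "\<And>x. \<bar>rinner (A x) x\<bar> \<le> rinner (P x) x + rinner (Q x) x"
  shows "(onorm A)\<^sup>2 \<le> onorm (\<lambda>x. P (P x) + Q (Q x)) + 2 * numrad (P \<circ> Q)"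
proof -
  define N where "N = onorm (\<lambda>x. P (P x) + Q (Q x)) + 2 * numrad (P \<circ> Q)"
  have sq: "bounded_linear (\<lambda>x. P (P x) + Q (Q x))"
    by (intro bounded_linear_add bounded_linear_compose[OF P(1)] bounded_linear_compose[OF Q(1)] P Q)
  have PQ: "bounded_linear (P \<circ> Q)"
    unfolding comp_def by (intro bounded_linear_compose[OF P(1)] Q)
  have sum_sq: "(norm (P x + Q x))\<^sup>2 \<le> N * (norm x)\<^sup>2" for x
  proof -
    \<comment> \<open>Symmetry of \<open>P\<close> turns the mixed term
      \<open>rinner (P x) (Q x)\<close> into the form of \<open>P \<circ> Q\<close>.\<close>
    have "(norm (P x + Q x))\<^sup>2 = rinner (P (P x) + Q (Q x)) x + 2 * rinner ((P \<circ> Q) x) x"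
      using rsymmetricD[OF P(2), of "P x" x] rsymmetricD[OF Q(2), of "Q x" x]
        rsymmetricD[OF P(2), of "Q x" x] rinner_commute[of "Q x" "P x"]
      by (simp add: norm_add_sq rinner_self rinner.add_left)
    also have "rinner (P (P x) + Q (Q x)) x \<le> norm (P (P x) + Q (Q x)) * norm x"
      by (rule rinner_le_norm)
    also have "\<dots> \<le> onorm (\<lambda>x. P (P x) + Q (Q x)) * norm x * norm x"
      by (intro mult_right_mono onorm[OF sq]) auto
    finally show ?thesis
      using rinner_le_numrad[OF PQ, of x] by (simp add: N_def power2_eq_square algebra_simps)
  qed
  show ?thesis
  proof (cases "\<exists>z::'a. z \<noteq> 0")
    \<comment> \<open>The zero space has no unit vectors, so \<open>numrad\<close> takes its default
      value and both sides are \<open>0\<close>.\<close>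
    case False
    then have zero: "y = 0" for y :: 'a by blast
    have "A = (\<lambda>x. 0)" "(\<lambda>x. P (P x) + Q (Q x)) = (\<lambda>x. 0)" by (rule ext, rule zero)+
    moreover have "norm x \<noteq> 1" for x :: 'a using zero[of x] by simp
    then have "{x::'a. norm x = 1} = {}" by blast
    ultimately show ?thesis by (simp add: numrad_def onorm_zero)
  next
    case True
    then obtain z :: 'a where "z \<noteq> 0" by blast
    \<comment> \<open>A nonzero vector reveals the sign of \<open>N\<close>, needed to take
      \<open>sqrt N\<close>.\<close>
    have "0 \<le> N * (norm z)\<^sup>2" using sum_sq[of z] by (meson order_trans zero_le_power2)
    then have N: "0 \<le> N" using \<open>z \<noteq> 0\<close> by (simp add: zero_le_mult_iff)
    have "\<bar>rinner (A x) x\<bar> \<le> sqrt N * (norm x)\<^sup>2" for x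
    proof -
      have "norm (P x + Q x) \<le> sqrt N * norm x"
        using real_sqrt_le_mono[OF sum_sq[of x]] by (simp add: real_sqrt_mult)
      then have "norm (P x + Q x) * norm x \<le> sqrt N * norm x * norm x"
        by (rule mult_right_mono) simp
      then show ?thesis
        using le[of x] rinner_le_norm[of "P x + Q x" x]
        by (simp add: rinner.add_left power2_eq_square)
    qed
    from norm_le_of_rinner_bound[OF bounded_linear.linear[OF A(1)] A(2) this]
    have "onorm A \<le> sqrt N" using N by (intro onorm_bound) simp_all
    then have "(onorm A)\<^sup>2 \<le> (sqrt N)\<^sup>2" by (intro power_mono onorm_pos_le A)
    then show ?thesis using N by (simp add: N_def)
  qed
qed

theorem mainTheorem14:
  fixes B C :: "'a::chilbert \<Rightarrow> 'a"
  assumes "bounded_op B" and "bounded_op C"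
    and "self_adjoint B" and "self_adjoint C"
  shows "max ((onorm (\<lambda>x. B x + C x))\<^sup>2) ((onorm (\<lambda>x. B x - C x))\<^sup>2)
           \<le> onorm (\<lambda>x. B (B x) + C (C x)) + 2 * numrad (op_abs B \<circ> op_abs C)"
proof -
  define P where "P = op_abs B"
  define Q where "Q = op_abs C"
  note P = op_abs_self_adjoint[OF assms(1,3), folded P_def]
  note Q = op_abs_self_adjoint[OF assms(2,4), folded Q_def]
  note sym = positive_op_rsymmetric[OF P(1,2)] positive_op_rsymmetric[OF Q(1,2)]
    self_adjoint_rsymmetric[OF assms(3)] self_adjoint_rsymmetric[OF assms(4)]
  have bl: "bounded_linear P" "bounded_linear Q" "bounded_linear B" "bounded_linear C"
    using P(1) Q(1) assms by (auto simp: bounded_op_def)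
  have dB: "\<bar>rinner (B x) x\<bar> \<le> rinner (P x) x" for x
    by (rule abs_rinner_le_of_norm_eq[OF bl(1) sym(1) bl(3) sym(3) positive_op_rinner[OF P(2)]
          rsymmetric_norm_eq[OF sym(1,3) P(3)]])
  have dC: "\<bar>rinner (C x) x\<bar> \<le> rinner (Q x) x" for x
    by (rule abs_rinner_le_of_norm_eq[OF bl(2) sym(2) bl(4) sym(4) positive_op_rinner[OF Q(2)]
          rsymmetric_norm_eq[OF sym(2,4) Q(3)]])
  have sq: "P (P x) + Q (Q x) = B (B x) + C (C x)" for x
    using P(3) Q(3) by (metis comp_apply)
  have "(onorm (\<lambda>x. B x + C x))\<^sup>2 \<le> onorm (\<lambda>x. P (P x) + Q (Q x)) + 2 * numrad (P \<circ> Q)"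
  proof (rule onorm_sq_le_of_abs_dominated[OF _ _ bl(1) sym(1) bl(2) sym(2)])
    show "bounded_linear (\<lambda>x. B x + C x)" by (intro bounded_linear_add bl)
    show "rsymmetric (\<lambda>x. B x + C x)"
      using sym by (simp add: rsymmetric_def rinner.add_left rinner.add_right)
    show "\<bar>rinner (B x + C x) x\<bar> \<le> rinner (P x) x + rinner (Q x) x" for x
      using dB[of x] dC[of x] by (simp add: rinner.add_left)
  qed
  moreover have "(onorm (\<lambda>x. B x - C x))\<^sup>2 \<le> onorm (\<lambda>x. P (P x) + Q (Q x)) + 2 * numrad (P \<circ> Q)"
  proof (rule onorm_sq_le_of_abs_dominated[OF _ _ bl(1) sym(1) bl(2) sym(2)])
    show "bounded_linear (\<lambda>x. B x - C x)" by (intro bounded_linear_sub bl)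
    show "rsymmetric (\<lambda>x. B x - C x)"
      using sym by (simp add: rsymmetric_def rinner.diff_left rinner.diff_right)
    \<comment> \<open>As \<open>dC\<close> bounds the absolute value of the form, changing the sign
      of \<open>C\<close> keeps the same majorant.\<close>
    show "\<bar>rinner (B x - C x) x\<bar> \<le> rinner (P x) x + rinner (Q x) x" for x
      using dB[of x] dC[of x] by (simp add: rinner.diff_left)
  qed
  ultimately show ?thesis by (simp add: sq P_def[symmetric] Q_def[symmetric])
qed

end
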